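(* Every private information distinguishing debate game $(A,S,P,C_w,C_l)$ has a policy with error at most $$\mathbb E_{s\sim P}\left[\begin{cases}\frac{|C_l(s)|}{|C_w(s)|+|C_l(s)|} & C_w(s)\cup C_l(s)\neq\emptyset\\ \frac12 & C_w(s)\cup C_l(s)=\emptyset\end{cases}\right].$$
   Context: Let $\delta$ be a special default action. A PIDDG is a tuple $(A,S,P,C_w,C_l)$ with $A$ finite, $\delta\notin A$, $S$ finite, $P$ a probability mass function on $S$, and $C_w,C_l:S\to\mathcal P(A)$. A policy is $M:\{1,2\}\times(A\cup\{\delta\})^2\to[0,1]$ with $M(1,a_1,a_2)+M(2,a_1,a_2)=1$. $G_1(B,M)$ is the following Bayesian game with agents $1,2$. Each agent has action set $A\cup\{\delta\}$ and type set $\mathcal P(A)$. A scenario $s\sim P$ is drawn, and agent 1 gets type $C_w(s)$ while agent 2 gets type $C_l(s)$. Payoffs are as follows: - if both agents play available actions ($a_i\in t_i\cup\{\delta\}$), agent $i$ gets $M(i,a_1,a_2)$; - if exactly one plays an unavailable action, it gets $0$ and the other gets $1$; - if both play unavailable actions, each gets $1/2$. $G_2(B,M)$ is the same with types swapped (agent 1 gets $C_l(s)$, agent 2 gets $C_w(s)$). The error is $\frac{v_1(G_2(B,M))+v_2(G_1(B,M))}{2}$, where $v_i$ is the value of the zero-sum Bayesian game to agent $i$. *)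

theory Defs
  imports Complex_Main
begin

text \<open>Actions: \<open>A \<union> {\<delta>}\<close> is modelled as \<open>'a option\<close>, with \<open>None\<close> the default action \<delta>
  and \<open>Some a\<close> the action \<open>a \<in> A\<close>.  Agents are numbered 1 and 2 (as naturals).\<close>

definition acts :: "'a set \<Rightarrow> 'a option set" where
  "acts A = Some ` A \<union> {None}"

definition available :: "'a set \<Rightarrow> 'a option \<Rightarrow> bool" where
  "available t x \<longleftrightarrow> x = None \<or> (\<exists>a\<in>t. x = Some a)"

definition piddg :: "'a set \<Rightarrow> 's set \<Rightarrow> ('s \<Rightarrow> real) \<Rightarrow> ('s \<Rightarrow> 'a set) \<Rightarrow> ('s \<Rightarrow> 'a set) \<Rightarrow> bool" where
  "piddg A S P Cw Cl \<longleftrightarrow> finite A \<and> finite S \<and> (\<forall>s\<in>S. P s \<ge> 0) \<and> (\<Sum>s\<in>S. P s) = 1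
     \<and> (\<forall>s\<in>S. Cw s \<subseteq> A \<and> Cl s \<subseteq> A)"

definition policy :: "'a set \<Rightarrow> (nat \<Rightarrow> 'a option \<Rightarrow> 'a option \<Rightarrow> real) \<Rightarrow> bool" where
  "policy A M \<longleftrightarrow> (\<forall>a1\<in>acts A. \<forall>a2\<in>acts A.
      (\<forall>i\<in>{1,2}. 0 \<le> M i a1 a2 \<and> M i a1 a2 \<le> 1) \<and> M 1 a1 a2 + M 2 a1 a2 = 1)"

definition payoff :: "(nat \<Rightarrow> 'a option \<Rightarrow> 'a option \<Rightarrow> real) \<Rightarrow> nat \<Rightarrow>
    'a set \<Rightarrow> 'a set \<Rightarrow> 'a option \<Rightarrow> 'a option \<Rightarrow> real" where
  "payoff M i t1 t2 x1 x2 =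
     (let av1 = available t1 x1; av2 = available t2 x2 in
      if av1 \<and> av2 then M i x1 x2
      else if av1 \<and> \<not> av2 then (if i = 1 then 1 else 0)
      else if \<not> av1 \<and> av2 then (if i = 1 then 0 else 1)
      else 1/2)"

definition strategies :: "'a set \<Rightarrow> ('a set \<Rightarrow> 'a option \<Rightarrow> real) set" where
  "strategies A = {\<sigma>. \<forall>t\<in>Pow A. (\<forall>x\<in>acts A. \<sigma> t x \<ge> 0) \<and> (\<Sum>x\<in>acts A. \<sigma> t x) = 1}"

definition exp_payoff :: "'a set \<Rightarrow> 's set \<Rightarrow> ('s \<Rightarrow> real) \<Rightarrow> ('s \<Rightarrow> 'a set) \<Rightarrow> ('s \<Rightarrow> 'a set) \<Rightarrow>
    (nat \<Rightarrow> 'a option \<Rightarrow> 'a option \<Rightarrow> real) \<Rightarrow> nat \<Rightarrow>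
    ('a set \<Rightarrow> 'a option \<Rightarrow> real) \<Rightarrow> ('a set \<Rightarrow> 'a option \<Rightarrow> real) \<Rightarrow> real" where
  "exp_payoff A S P T1 T2 M i \<sigma>1 \<sigma>2 =
     (\<Sum>s\<in>S. P s * (\<Sum>x1\<in>acts A. \<Sum>x2\<in>acts A.
         \<sigma>1 (T1 s) x1 * \<sigma>2 (T2 s) x2 * payoff M i (T1 s) (T2 s) x1 x2))"

text \<open>Value of the (constant-sum) Bayesian game to agent \<open>i\<close>: the max-min value
  \<open>sup_{\<sigma>_i} inf_{\<sigma>_{-i}}\<close> of its expected payoff (equal to the min-max value by the
  minimax theorem, the game being finite).\<close>
definition game_value :: "'a set \<Rightarrow> 's set \<Rightarrow> ('s \<Rightarrow> real) \<Rightarrow> ('s \<Rightarrow> 'a set) \<Rightarrow> ('s \<Rightarrow> 'a set) \<Rightarrow>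
    (nat \<Rightarrow> 'a option \<Rightarrow> 'a option \<Rightarrow> real) \<Rightarrow> nat \<Rightarrow> real" where
  "game_value A S P T1 T2 M i =
     (if i = 1 then
        (SUP \<sigma>1\<in>strategies A. INF \<sigma>2\<in>strategies A. exp_payoff A S P T1 T2 M 1 \<sigma>1 \<sigma>2)
      else
        (SUP \<sigma>2\<in>strategies A. INF \<sigma>1\<in>strategies A. exp_payoff A S P T1 T2 M 2 \<sigma>1 \<sigma>2))"

definition error :: "'a set \<Rightarrow> 's set \<Rightarrow> ('s \<Rightarrow> real) \<Rightarrow> ('s \<Rightarrow> 'a set) \<Rightarrow> ('s \<Rightarrow> 'a set) \<Rightarrow>
    (nat \<Rightarrow> 'a option \<Rightarrow> 'a option \<Rightarrow> real) \<Rightarrow> real" where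
  "error A S P Cw Cl M =
     (game_value A S P Cl Cw M 1 + game_value A S P Cw Cl M 2) / 2"

end

theory Submission
  imports Defs "HOL-Combinatorics.Permutations"
begin

text \<open>Rank two disjoint copies of \<open>A\<close>, one for the actions of each agent, with the default action
  below everything, and let the agent that plays the higher ranked action win. Playing the highest
  ranked available action guarantees the agent with the type \<open>Cw s\<close> a win unless the top element of
  the disjoint union of \<open>Cw s\<close> and \<open>Cl s\<close> comes from \<open>Cl s\<close>. Under a uniformly random ranking this
  has probability \<open>|Cl s| / (|Cw s| + |Cl s|)\<close>, so the average error over all rankings is within the
  bound, and some ranking is at least as good as the average.\<close>

lemma available_iff_acts: "available t x \<longleftrightarrow> x \<in> acts t"
  by (auto simp: available_def acts_def)

lemma finite_ex_maximizer:
  fixes f :: "'z \<Rightarrow> nat"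
  assumes "finite U" "U \<noteq> {}"
  shows "\<exists>u\<in>U. \<forall>v\<in>U. f v \<le> f u"
  using Max_in[of "f ` U"] Max_ge[of "f ` U"] assms by fastforce

lemma finite_acts: "finite A \<Longrightarrow> finite (acts A)"
  by (simp add: acts_def)

section \<open>Location of the top element under a uniformly random ranking\<close>

definition tops :: "('z \<Rightarrow> nat) \<Rightarrow> 'z set \<Rightarrow> 'z set \<Rightarrow> bool" where
  "tops r X Y \<longleftrightarrow> (\<exists>u\<in>X. \<forall>v\<in>X \<union> Y. r v \<le> r u)"

text \<open>The value 1/2 matches the payoff when neither agent has a real action and both are left
  with the default.\<close>

definition top_score :: "('z \<Rightarrow> nat) \<Rightarrow> 'z set \<Rightarrow> 'z set \<Rightarrow> real" where
  "top_score r X Y = (if X \<union> Y \<noteq> {} then of_bool (tops r X Y) else 1/2)"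

lemma maximal_at_unique:
  fixes g :: "'z \<Rightarrow> nat"
  assumes "p permutes Z" "inj_on g Z" "U \<subseteq> Z" "x \<in> U" "y \<in> U"
    and "\<forall>v\<in>U. g (p v) \<le> g (p x)" "\<forall>v\<in>U. g (p v) \<le> g (p y)"
  shows "x = y"
proof -
  have "g (p x) = g (p y)" using assms by (simp add: eq_iff)
  moreover have "p x \<in> Z" "p y \<in> Z" using assms by (auto simp: permutes_in_image)
  ultimately have "p x = p y" using assms(2) by (auto dest: inj_onD)
  then show ?thesis using assms(1) by (auto dest: permutes_inj injD)
qed

text \<open>By symmetry: precomposing with the transposition of \<open>u\<close> and
  \<open>w\<close> is an involution that preserves \<open>U\<close> and exchanges the two
  events.\<close>

lemma card_permutations_maximal_at_eq:
  fixes g :: "'z \<Rightarrow> nat"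
  assumes "U \<subseteq> Z" "u \<in> U" "w \<in> U"
  shows "card {p. p permutes Z \<and> (\<forall>v\<in>U. g (p v) \<le> g (p u))} =
         card {p. p permutes Z \<and> (\<forall>v\<in>U. g (p v) \<le> g (p w))}" (is "card (?N u) = card (?N w)")
proof -
  define \<tau> where "\<tau> = transpose u w"
  have \<tau>: "\<tau> permutes Z" "\<tau> \<circ> \<tau> = id" "\<tau> u = w" "\<tau> w = u"
    using assms by (auto simp: \<tau>_def intro!: permutes_swap_id)
  have \<tau>U: "\<tau> v \<in> U" if "v \<in> U" for v
    using that assms by (auto simp: \<tau>_def transpose_def)
  have mem: "p \<circ> \<tau> \<in> ?N y" if "p \<in> ?N x" "\<tau> y = x" for p x y
    using that \<tau> \<tau>U by (auto intro: permutes_compose)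
  have inv: "(p \<circ> \<tau>) \<circ> \<tau> = p" for p :: "'z \<Rightarrow> 'z"
    by (simp add: comp_assoc \<tau>)
  have "bij_betw (\<lambda>p. p \<circ> \<tau>) (?N u) (?N w)"
    by (rule bij_betw_byWitness[where f' = "\<lambda>p. p \<circ> \<tau>"]) (use inv mem \<tau> in blast)+
  then show ?thesis by (rule bij_betw_same_card)
qed

text \<open>The events "\<open>u\<close> is on top of \<open>U\<close>" partition the permutations,
  since \<open>g\<close> is injective, and all have the same size. So each has probability
  1/|U|.\<close>

lemma card_permutations_maximal_at:
  fixes g :: "'z \<Rightarrow> nat"
  assumes "finite Z" "inj_on g Z" "U \<subseteq> Z" "u \<in> U"
  shows "card U * card {p. p permutes Z \<and> (\<forall>v\<in>U. g (p v) \<le> g (p u))} = card {p. p permutes Z}"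
proof -
  let ?N = "\<lambda>u. {p. p permutes Z \<and> (\<forall>v\<in>U. g (p v) \<le> g (p u))}"
  have fU: "finite U" using assms finite_subset by blast
  have fin: "finite {p. p permutes Z}" using assms by (simp add: finite_permutations)
  have "\<exists>u\<in>U. \<forall>v\<in>U. g (p v) \<le> g (p u)" for p
    using finite_ex_maximizer[of U "\<lambda>v. g (p v)"] fU \<open>u \<in> U\<close> by blast
  then have Un: "{p. p permutes Z} = (\<Union>u\<in>U. ?N u)" by auto
  have "x = y" if "p \<in> ?N x" "p \<in> ?N y" "x \<in> U" "y \<in> U" for p x y
    using that maximal_at_unique[OF _ assms(2,3)] by blast
  then have "card (\<Union>u\<in>U. ?N u) = (\<Sum>u\<in>U. card (?N u))"
    by (intro card_UN_disjoint fU) (auto intro: finite_subset[OF _ fin])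
  also have "\<dots> = (\<Sum>w\<in>U. card (?N u))"
    using assms by (intro sum.cong refl card_permutations_maximal_at_eq) auto
  finally show ?thesis by (simp add: Un)
qed

text \<open>The top of \<open>X \<union> Y\<close> lies in \<open>X\<close> iff it is one of the
  card \<open>X\<close> elements of \<open>X\<close>. These events are disjoint, and each has
  probability 1/(|X| + |Y|) because \<open>X\<close> and \<open>Y\<close> are disjoint.\<close>

lemma sum_permutations_top_score:
  fixes g :: "'z \<Rightarrow> nat"
  assumes "finite Z" "inj_on g Z" "X \<subseteq> Z" "Y \<subseteq> Z" "X \<inter> Y = {}"
  shows "(\<Sum>p | p permutes Z. top_score (g \<circ> p) X Y) = real (card {p. p permutes Z}) *
    (if X \<union> Y \<noteq> {} then real (card X) / (real (card X) + real (card Y)) else 1/2)"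
proof (cases "X \<union> Y = {}")
  case True
  then show ?thesis by (simp add: top_score_def)
next
  case False
  let ?F = "{p. p permutes Z}"
  let ?N = "\<lambda>u. {p. p permutes Z \<and> (\<forall>v\<in>X \<union> Y. g (p v) \<le> g (p u))}"
  have fX: "finite X" "finite Y" using assms finite_subset by blast+
  have fin: "finite ?F" using assms by (simp add: finite_permutations)
  have cU: "card (X \<union> Y) = card X + card Y" using fX assms by (simp add: card_Un_disjoint)
  have pos: "real (card X) + real (card Y) > 0"
    using False fX cU by (metis card_gt_0_iff finite_UnI of_nat_add of_nat_0_less_iff)
  have N: "real (card (?N u)) = real (card ?F) / (real (card X) + real (card Y))" if "u \<in> X" for u
  proof -
    have "real (card X + card Y) * real (card (?N u)) = real (card ?F)"
      using card_permutations_maximal_at[OF assms(1,2), of "X \<union> Y" u] assms that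
      unfolding cU of_nat_mult[symmetric] by simp
    then show ?thesis using pos by (simp add: field_simps)
  qed
  have "x = y" if "p \<in> ?N x" "p \<in> ?N y" "x \<in> X" "y \<in> X" for p x y
    using that maximal_at_unique[OF _ assms(2), of p "X \<union> Y" x y] assms(3,4) by blast
  then have "card (\<Union>u\<in>X. ?N u) = (\<Sum>u\<in>X. card (?N u))"
    by (intro card_UN_disjoint fX) (auto intro: finite_subset[OF _ fin])
  then have card: "real (card (\<Union>u\<in>X. ?N u)) =
      real (card X) * (real (card ?F) / (real (card X) + real (card Y)))"
    using N by simp
  have "(\<Sum>p\<in>?F. top_score (g \<circ> p) X Y) = (\<Sum>p\<in>?F. of_bool (p \<in> (\<Union>u\<in>X. ?N u)))"
    using False by (intro sum.cong) (auto simp: top_score_def tops_def)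
  also have "\<dots> = real (card (?F \<inter> (\<Union>u\<in>X. ?N u)))"
    using fin by (simp add: sum.If_cases of_bool_def Int_def)
  also have "?F \<inter> (\<Union>u\<in>X. ?N u) = (\<Union>u\<in>X. ?N u)" by auto
  finally show ?thesis using False card by (simp add: comp_def mult.commute)
qed

section \<open>Policies given by rankings, and best replies to them\<close>

definition action_rank :: "(nat \<times> 'a \<Rightarrow> nat) \<Rightarrow> nat \<Rightarrow> 'a option \<Rightarrow> nat" where
  "action_rank r k x = (case x of None \<Rightarrow> 0 | Some a \<Rightarrow> Suc (r (k, a)))"

text \<open>For \<open>r\<close> injective on both copies of \<open>A\<close>, the tie branch is
  reached only when both agents play the default. Comparing with \<open>i = 1\<close> makes the two
  agents' shares complementary.\<close>

definition rank_policy :: "(nat \<times> 'a \<Rightarrow> nat) \<Rightarrow> nat \<Rightarrow> 'a option \<Rightarrow> 'a option \<Rightarrow> real" where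
  "rank_policy r i x y =
    (if action_rank r 1 x = action_rank r 2 y then 1/2
     else of_bool ((action_rank r 1 x > action_rank r 2 y) = (i = 1)))"

lemma policy_rank_policy: "policy A (rank_policy r)"
  by (auto simp: policy_def rank_policy_def)

lemma top_score_nonneg: "0 \<le> top_score r X Y"
  by (simp add: top_score_def)

lemma ex_best_action:
  assumes "finite t"
  shows "\<exists>x\<in>acts t. \<forall>y\<in>acts t. action_rank r k y \<le> action_rank r k x"
  using finite_acts[OF assms] by (intro finite_ex_maximizer) (auto simp: acts_def)

text \<open>Agent \<open>j\<close> holds \<open>w\<close> and plays its highest action
  \<open>y\<close>. If an available \<open>x\<close> beats \<open>y\<close>, it outranks all of
  \<open>w\<close>, so the overall top lies in \<open>l\<close>. A tie occurs only between defaults,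
  which forces \<open>w\<close> to be empty.\<close>

lemma top_score_ge_best_response:
  assumes "finite l" and inj: "inj_on r ({1, 2} \<times> A)" and "l \<subseteq> A" "w \<subseteq> A" "i \<noteq> j" "i \<in> {1, 2}" "j \<in> {1, 2}"
    and x: "x \<in> acts l" and y: "y \<in> acts w"
    and best: "\<forall>z\<in>acts w. action_rank r j z \<le> action_rank r j y"
  shows "(if action_rank r i x = action_rank r j y then 1/2
      else of_bool (action_rank r i x > action_rank r j y)) \<le> top_score r ({i} \<times> l) ({j} \<times> w)"
proof -
  have topI: "tops r ({i} \<times> l) ({j} \<times> w)"
    if "l \<noteq> {}" "\<forall>b\<in>w. \<exists>a\<in>l. r (j, b) \<le> r (i, a)"
  proof -
    obtain a where a: "a \<in> l" "\<forall>c\<in>l. r (i, c) \<le> r (i, a)"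
      using finite_ex_maximizer[of l "\<lambda>a. r (i, a)"] \<open>finite l\<close> \<open>l \<noteq> {}\<close> by blast
    then have "\<forall>b\<in>w. r (j, b) \<le> r (i, a)" using that(2) by (meson order_trans)
    with a show ?thesis unfolding tops_def by auto
  qed
  have rank_best: "Suc (r (j, b)) \<le> action_rank r j y" if "b \<in> w" for b
    using best that by (force simp: acts_def action_rank_def)
  consider (eq) "action_rank r i x = action_rank r j y" | (gt) "action_rank r i x > action_rank r j y"
    | (lt) "action_rank r i x < action_rank r j y" by linarith
  then show ?thesis
  proof cases
    case eq
    \<comment> \<open>A tie at positive rank would identify an action in copy \<open>i\<close> with
      one in copy \<open>j\<close>, contradicting injectivity.\<close>
    have "x = None"
    proof (rule ccontr)
      assume "x \<noteq> None"
      then obtain a b where "x = Some a" "y = Some b" "a \<in> l" "b \<in> w" "r (i, a) = r (j, b)"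
        using eq x y by (auto simp: acts_def action_rank_def split: option.splits)
      then show False using inj assms by (auto dest: inj_onD)
    qed
    then have "action_rank r j y = 0" using eq by (simp add: action_rank_def)
    then have "w = {}" using rank_best by fastforce
    \<comment> \<open>With \<open>w\<close> empty the score is 1 if \<open>l\<close> is nonempty and
      1/2 otherwise, so it covers the tie payoff 1/2.\<close>
    then show ?thesis using eq topI by (auto simp: top_score_def)
  next
    case gt
    then obtain a where a: "x = Some a" "a \<in> l"
      using x by (auto simp: acts_def action_rank_def)
    then have "r (j, b) \<le> r (i, a)" if "b \<in> w" for b
      using rank_best[OF that] gt by (simp add: action_rank_def)
    then show ?thesis using gt a topI by (auto simp: top_score_def)
  next
    case lt
    then show ?thesis by (simp add: top_score_def)
  qed
qed

section \<open>Bounds on game values and on the error\<close>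

lemma game_value_1_le:
  assumes A: "finite A" and P: "\<And>s. s \<in> S \<Longrightarrow> P s \<ge> 0"
    and T: "\<And>s. s \<in> S \<Longrightarrow> T1 s \<subseteq> A" "\<And>s. s \<in> S \<Longrightarrow> T2 s \<subseteq> A"
    and M: "\<And>x y. 0 \<le> M 1 x y"
    and h: "\<And>t. t \<subseteq> A \<Longrightarrow> h t \<in> acts A"
    and c: "\<And>s x. s \<in> S \<Longrightarrow> payoff M 1 (T1 s) (T2 s) x (h (T2 s)) \<le> c s"
  shows "game_value A S P T1 T2 M 1 \<le> (\<Sum>s\<in>S. P s * c s)"
proof -
  have fin: "finite (acts A)" using A by (rule finite_acts)
  \<comment> \<open>The pure reply \<open>h\<close> as a mixed strategy. Fixing this opponent
    strategy bounds the infimum for every strategy of agent 1.\<close>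
  define \<eta> where "\<eta> = (\<lambda>t x. of_bool (x = h t) :: real)"
  have \<eta>: "\<eta> \<in> strategies A"
    using h fin by (auto simp: strategies_def \<eta>_def of_bool_def)
  have payoff_nonneg: "0 \<le> payoff M 1 t1 t2 x y" for t1 t2 x y
    using M by (simp add: payoff_def Let_def)
  \<comment> \<open>The reals are only conditionally complete, so bounding the infimum by its value
    at \<open>\<eta>\<close> needs a lower bound; nonnegative payoffs supply 0.\<close>
  have bdd: "bdd_below ((\<lambda>\<sigma>2. exp_payoff A S P T1 T2 M 1 \<sigma>1 \<sigma>2) ` strategies A)"
    if \<sigma>1: "\<sigma>1 \<in> strategies A" for \<sigma>1
    using \<sigma>1 P T payoff_nonneg
    by (intro bdd_belowI2[where m = 0])
      (auto simp: exp_payoff_def strategies_def intro!: sum_nonneg mult_nonneg_nonneg)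
  have bound: "exp_payoff A S P T1 T2 M 1 \<sigma> \<eta> \<le> (\<Sum>s\<in>S. P s * c s)"
    if \<sigma>: "\<sigma> \<in> strategies A" for \<sigma>
    unfolding exp_payoff_def
  proof (intro sum_mono mult_left_mono P)
    fix s assume s: "s \<in> S"
    have nonneg: "\<sigma> (T1 s) x \<ge> 0" if "x \<in> acts A" for x
      using \<sigma> T(1)[OF s] that by (auto simp: strategies_def)
    have total: "(\<Sum>x\<in>acts A. \<sigma> (T1 s) x) = 1"
      using \<sigma> T(1)[OF s] by (auto simp: strategies_def)
    have "(\<Sum>x1\<in>acts A. \<Sum>x2\<in>acts A. \<sigma> (T1 s) x1 * \<eta> (T2 s) x2 * payoff M 1 (T1 s) (T2 s) x1 x2)
        = (\<Sum>x1\<in>acts A. \<sigma> (T1 s) x1 * payoff M 1 (T1 s) (T2 s) x1 (h (T2 s)))"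
    proof (rule sum.cong[OF refl])
      fix x1
      have "(\<Sum>x2\<in>acts A. \<sigma> (T1 s) x1 * \<eta> (T2 s) x2 * payoff M 1 (T1 s) (T2 s) x1 x2)
        = (\<Sum>x2\<in>acts A. if h (T2 s) = x2 then \<sigma> (T1 s) x1 * payoff M 1 (T1 s) (T2 s) x1 x2 else 0)"
        by (intro sum.cong) (auto simp: \<eta>_def)
      also have "\<dots> = \<sigma> (T1 s) x1 * payoff M 1 (T1 s) (T2 s) x1 (h (T2 s))"
        using h[OF T(2)[OF s]] fin by (simp add: sum.delta)
      finally show "(\<Sum>x2\<in>acts A. \<sigma> (T1 s) x1 * \<eta> (T2 s) x2 * payoff M 1 (T1 s) (T2 s) x1 x2)
        = \<sigma> (T1 s) x1 * payoff M 1 (T1 s) (T2 s) x1 (h (T2 s))" .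
    qed
    also have "\<dots> \<le> (\<Sum>x1\<in>acts A. \<sigma> (T1 s) x1 * c s)"
      using nonneg c[OF s] by (intro sum_mono mult_left_mono) auto
    also have "\<dots> = c s" using total by (simp flip: sum_distrib_right)
    finally show "(\<Sum>x1\<in>acts A. \<Sum>x2\<in>acts A.
        \<sigma> (T1 s) x1 * \<eta> (T2 s) x2 * payoff M 1 (T1 s) (T2 s) x1 x2) \<le> c s" .
  qed
  show ?thesis
    unfolding game_value_def if_P[OF refl]
  proof (rule cSUP_least)
    show "strategies A \<noteq> {}" using \<eta> by blast
    fix \<sigma>1 assume "\<sigma>1 \<in> strategies A"
    then show "(INF \<sigma>2\<in>strategies A. exp_payoff A S P T1 T2 M 1 \<sigma>1 \<sigma>2) \<le> (\<Sum>s\<in>S. P s * c s)"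
      using bdd bound \<eta> by (intro cINF_lower2)
  qed
qed

text \<open>Renaming the agents exchanges the types and transposes the payoff table, so bounds for
  agent 1 carry over to agent 2.\<close>

lemma game_value_2_eq_swap:
  "game_value A S P T1 T2 M 2 = game_value A S P T2 T1 (\<lambda>_ x y. M 2 y x) 1"
proof -
  have payoff: "payoff M 2 t1 t2 x y = payoff (\<lambda>_ x y. M 2 y x) 1 t2 t1 y x" for t1 t2 x y
    by (auto simp: payoff_def Let_def)
  have "exp_payoff A S P T1 T2 M 2 \<sigma>1 \<sigma>2 = exp_payoff A S P T2 T1 (\<lambda>_ x y. M 2 y x) 1 \<sigma>2 \<sigma>1"
    for \<sigma>1 \<sigma>2
    unfolding exp_payoff_def payoff
    by (subst sum.swap) (simp add: mult.commute mult.left_commute)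
  then show ?thesis by (simp add: game_value_def)
qed

text \<open>In both games the holder of \<open>Cw s\<close> plays its top available action. The
  holder of \<open>Cl s\<close> is agent 1 in one game and agent 2 in the other, hence the two ways
  of tagging the copies.\<close>

lemma error_rank_policy_le:
  assumes B: "piddg A S P Cw Cl" and inj: "inj_on r ({1, 2} \<times> A)"
  shows "error A S P Cw Cl (rank_policy r) \<le>
    (\<Sum>s\<in>S. P s * ((top_score r ({1} \<times> Cl s) ({2} \<times> Cw s) +
                     top_score r ({2} \<times> Cl s) ({1} \<times> Cw s)) / 2))"
proof -
  from B have A: "finite A" and P: "\<And>s. s \<in> S \<Longrightarrow> P s \<ge> 0"
    and C: "\<And>s. s \<in> S \<Longrightarrow> Cw s \<subseteq> A" "\<And>s. s \<in> S \<Longrightarrow> Cl s \<subseteq> A"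
    by (auto simp: piddg_def)
  have "\<exists>h. \<forall>t\<in>Pow A. h t \<in> acts t \<and> (\<forall>y\<in>acts t. action_rank r k y \<le> action_rank r k (h t))" for k
    using ex_best_action[OF finite_subset[OF _ A], of _ r k] by (intro bchoice) blast
  then obtain h where h: "\<And>k t. t \<subseteq> A \<Longrightarrow> h k t \<in> acts t"
    "\<And>k t. t \<subseteq> A \<Longrightarrow> \<forall>y\<in>acts t. action_rank r k y \<le> action_rank r k (h k t)"
    by (metis PowI)
  have hA: "h k t \<in> acts A" if "t \<subseteq> A" for k t
    using h(1)[OF that, of k] that by (auto simp: acts_def)
  have score: "(if action_rank r i x = action_rank r j (h j (Cw s)) then 1/2
      else of_bool (action_rank r i x > action_rank r j (h j (Cw s))))
      \<le> top_score r ({i} \<times> Cl s) ({j} \<times> Cw s)"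
    if "s \<in> S" "i \<noteq> j" "i \<in> {1, 2}" "j \<in> {1, 2}" "x \<in> acts (Cl s)" for i j x s
    using that C h inj finite_subset[OF C(2) A]
    by (intro top_score_ge_best_response[of _ _ A]) auto
  have "game_value A S P Cl Cw (rank_policy r) 1 \<le>
      (\<Sum>s\<in>S. P s * top_score r ({1} \<times> Cl s) ({2} \<times> Cw s))"
  proof (rule game_value_1_le[where h = "h 2"])
    fix s x assume s: "s \<in> S"
    show "payoff (rank_policy r) 1 (Cl s) (Cw s) x (h 2 (Cw s))
        \<le> top_score r ({1} \<times> Cl s) ({2} \<times> Cw s)"
      using score[OF s, of 1 2 x] h(1)[OF C(1)[OF s], of 2] top_score_nonneg
      by (auto simp: payoff_def Let_def available_iff_acts rank_policy_def simp del: One_nat_def)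
  qed (use A P C hA in \<open>auto simp: rank_policy_def\<close>)
  moreover have "game_value A S P Cw Cl (rank_policy r) 2 \<le>
      (\<Sum>s\<in>S. P s * top_score r ({2} \<times> Cl s) ({1} \<times> Cw s))"
    unfolding game_value_2_eq_swap
  proof (rule game_value_1_le[where h = "h 1"])
    fix s x assume s: "s \<in> S"
    show "payoff (\<lambda>_ x y. rank_policy r 2 y x) 1 (Cl s) (Cw s) x (h 1 (Cw s))
        \<le> top_score r ({2} \<times> Cl s) ({1} \<times> Cw s)"
      using score[OF s, of 2 1 x] h(1)[OF C(1)[OF s], of 1] top_score_nonneg
      by (auto simp: payoff_def Let_def available_iff_acts rank_policy_def not_less
          simp del: One_nat_def split: if_splits)
  qed (use A P C hA in \<open>auto simp: rank_policy_def\<close>)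
  ultimately have "error A S P Cw Cl (rank_policy r) \<le>
      ((\<Sum>s\<in>S. P s * top_score r ({1} \<times> Cl s) ({2} \<times> Cw s)) +
       (\<Sum>s\<in>S. P s * top_score r ({2} \<times> Cl s) ({1} \<times> Cw s))) / 2"
    by (simp add: error_def)
  also have "\<dots> = (\<Sum>s\<in>S. P s * ((top_score r ({1} \<times> Cl s) ({2} \<times> Cw s) +
                     top_score r ({2} \<times> Cl s) ({1} \<times> Cw s)) / 2))"
    by (simp add: sum.distrib sum_divide_distrib add_divide_distrib distrib_left)
  finally show ?thesis .
qed

section \<open>Averaging over all rankings\<close>

theorem theorem5p3:
  fixes A :: "'a set" and S :: "'s set" and P :: "'s \<Rightarrow> real"
    and Cw Cl :: "'s \<Rightarrow> 'a set"
  assumes "piddg A S P Cw Cl"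
  shows "\<exists>M. policy A M \<and>
    error A S P Cw Cl M \<le>
      (\<Sum>s\<in>S. P s * (if Cw s \<union> Cl s \<noteq> {}
                       then real (card (Cl s)) / (real (card (Cw s)) + real (card (Cl s)))
                       else 1/2))"
    (is "\<exists>M. _ \<and> _ \<le> (\<Sum>s\<in>S. P s * ?b s)")
proof -
  from assms have A: "finite A" and C: "\<And>s. s \<in> S \<Longrightarrow> Cw s \<subseteq> A" "\<And>s. s \<in> S \<Longrightarrow> Cl s \<subseteq> A"
    by (auto simp: piddg_def)
  define Z where "Z = {1, 2::nat} \<times> A"
  define F where "F = {p. p permutes Z}"
  have finZ: "finite Z" using A by (simp add: Z_def)
  then have F: "finite F" "F \<noteq> {}" by (auto simp: F_def finite_permutations intro: permutes_id)
  \<comment> \<open>One injection \<open>g\<close> suffices: the maps \<open>g \<circ> p\<close>,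
    for \<open>p\<close> permuting \<open>Z\<close>, give every ordering of
    \<open>Z\<close>.\<close>
  obtain g :: "nat \<times> 'a \<Rightarrow> nat" where g: "inj_on g Z"
    using finite_imp_inj_to_nat_seg[OF finZ] by blast
  let ?sc = "\<lambda>p s. (top_score (g \<circ> p) ({1} \<times> Cl s) ({2} \<times> Cw s) +
                     top_score (g \<circ> p) ({2} \<times> Cl s) ({1} \<times> Cw s)) / 2"
  \<comment> \<open>Tagging preserves cardinalities and makes the copies disjoint, so both games
    have the same average score.\<close>
  have avg: "(\<Sum>p\<in>F. ?sc p s) = real (card F) * ?b s" if "s \<in> S" for s
  proof -
    have "(\<Sum>p\<in>F. top_score (g \<circ> p) ({i} \<times> Cl s) ({j} \<times> Cw s)) = real (card F) * ?b s"
      if "i \<noteq> j" "i \<in> {1, 2}" "j \<in> {1, 2}" for i j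
      unfolding F_def
      by (subst sum_permutations_top_score[OF finZ g])
        (use that C \<open>s \<in> S\<close> in \<open>auto simp: Z_def card_cartesian_product_singleton add.commute\<close>)
    from this[of 1 2] this[of 2 1] show ?thesis
      by (simp add: sum.distrib flip: sum_divide_distrib)
  qed
  have "(\<Sum>p\<in>F. error A S P Cw Cl (rank_policy (g \<circ> p))) \<le> (\<Sum>p\<in>F. \<Sum>s\<in>S. P s * ?sc p s)"
  proof (intro sum_mono error_rank_policy_le assms)
    fix p assume "p \<in> F"
    then have "p permutes Z" by (simp add: F_def)
    then show "inj_on (g \<circ> p) ({1, 2} \<times> A)"
      using g unfolding Z_def[symmetric] by (simp add: comp_inj_on permutes_image permutes_inj_on)
  qed
  also have "\<dots> = (\<Sum>s\<in>S. P s * (\<Sum>p\<in>F. ?sc p s))"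
    by (subst sum.swap) (simp add: sum_distrib_left)
  also have "\<dots> = (\<Sum>s\<in>S. P s * (real (card F) * ?b s))"
    using avg by (intro sum.cong) simp_all
  also have "\<dots> = (\<Sum>p\<in>F. \<Sum>s\<in>S. P s * ?b s)"
    by (simp add: sum_distrib_left mult.left_commute)
  \<comment> \<open>Otherwise every error would exceed the bound, and summing over the nonempty
    finite \<open>F\<close> would contradict the inequality just obtained.\<close>
  finally have "\<exists>p\<in>F. error A S P Cw Cl (rank_policy (g \<circ> p)) \<le> (\<Sum>s\<in>S. P s * ?b s)"
    using sum_strict_mono[OF F, of "\<lambda>_. \<Sum>s\<in>S. P s * ?b s"] by (meson not_less)
  then show ?thesis using policy_rank_policy by blast
qed

end
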